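(* In the curved $4$-body problem in $\mathbb S^2$ there are no fixed points inscribed in any great circle such that the bodies form a trapezoid with equal masses on each of the parallel sides. That is, if $m_1=m_2=:m>0$ and $m_3=m_4=:M>0$, then there is no fixed point ${\bf q}=({\bf q}_1,{\bf q}_2,{\bf q}_3,{\bf q}_4)$ of the equations of motion for which all four points lie on one great circle of $\mathbb S^2$ and are the vertices of a (Euclidean) trapezoid, in the plane of that great circle, whose parallel sides are the chord joining ${\bf q}_1$ and ${\bf q}_2$ and the chord joining ${\bf q}_3$ and ${\bf q}_4$.
   Context: $\mathbb S^2=\{(x,y,z)\in\mathbb R^3 : x^2+y^2+z^2=1\}$, and $\cdot$ is the standard inner product of $\mathbb R^3$. The curved $4$-body problem in $\mathbb S^2$ describes the motion of bodies of masses $m_1,m_2,m_3,m_4>0$ with position vectors ${\bf q}_i\in\mathbb S^2$ through the equations $$\ddot{\bf q}_i=\sum_{j=1,\,j\ne i}^4\frac{m_j[{\bf q}_j-({\bf q}_i\cdot{\bf q}_j){\bf q}_i]}{[1-({\bf q}_i\cdot{\bf q}_j)^2]^{3/2}}-(\dot{\bf q}_i\cdot\dot{\bf q}_i){\bf q}_i,\qquad i=1,2,3,4,$$ with initial constraints $({\bf q}_i\cdot{\bf q}_i)(0)=1$, $({\bf q}_i\cdot\dot{\bf q}_i)(0)=0$. The equations are undefined (singular) if two bodies coincide or are antipodal, so such configurations are excluded; in particular rectangles inscribed in great circles are excluded. A fixed point is a static solution, i.e. a nonsingular configuration for which $\ddot{\bf q}_i(0)=\dot{\bf q}_i(0)={\bf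 0}$ for $i=1,2,3,4$. The trapezoid is regarded as a Euclidean trapezoid in the plane of the great circle. *)

theory Defs
  imports "HOL-Analysis.Analysis"
begin

text \<open>
  The unit sphere of \<open>\<real>\<^sup>3\<close> is \<open>sphere 0 1 :: (real^3) set\<close>. The four bodies are indexed by
  the four-element type \<open>4\<close>, whose elements are \<open>1, 2, 3, 4\<close> (with \<open>4 = 0\<close>).
\<close>

type_synonym config = "4 \<Rightarrow> real^3"

definition nonsingular :: "config \<Rightarrow> bool" where
  "nonsingular q \<longleftrightarrow> (\<forall>i j. i \<noteq> j \<longrightarrow> q i \<noteq> q j \<and> q i \<noteq> - q j)"

definition acceleration :: "(4 \<Rightarrow> real) \<Rightarrow> config \<Rightarrow> config \<Rightarrow> config" where
  "acceleration \<mu> q v i =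
     (\<Sum>j \<in> UNIV - {i}.
        (\<mu> j / (1 - (q i \<bullet> q j)\<^sup>2) powr (3/2)) *\<^sub>R (q j - (q i \<bullet> q j) *\<^sub>R q i))
     - (v i \<bullet> v i) *\<^sub>R q i"

text \<open>
  Solutions with positions \<open>q\<close> and velocities \<open>v\<close> on the time interval \<open>{-T<..<T}\<close>. The two
  sphere constraints are imposed at time \<open>0\<close> only.
\<close>

definition is_solution ::
    "(4 \<Rightarrow> real) \<Rightarrow> real \<Rightarrow> (real \<Rightarrow> config) \<Rightarrow> (real \<Rightarrow> config) \<Rightarrow> bool" where
  "is_solution \<mu> T q v \<longleftrightarrow>
     T > 0 \<and>
     (\<forall>i. q 0 i \<bullet> q 0 i = 1 \<and> q 0 i \<bullet> v 0 i = 0) \<and>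
     (\<forall>t. - T < t \<and> t < T \<longrightarrow>
        nonsingular (q t) \<and>
        (\<forall>i. ((\<lambda>s. q s i) has_vector_derivative v t i) (at t) \<and>
             ((\<lambda>s. v s i) has_vector_derivative acceleration \<mu> (q t) (v t) i) (at t)))"

definition fixed_point :: "(4 \<Rightarrow> real) \<Rightarrow> config \<Rightarrow> bool" where
  "fixed_point \<mu> p \<longleftrightarrow>
     (\<exists>T q v. is_solution \<mu> T q v \<and> q 0 = p \<and>
        (\<forall>i. v 0 i = 0 \<and> ((\<lambda>s. v s i) has_vector_derivative 0) (at 0)))"

definition great_circle :: "(real^3) set \<Rightarrow> bool" where
  "great_circle C \<longleftrightarrow> (\<exists>n. n \<noteq> 0 \<and> C = sphere 0 1 \<inter> {x. n \<bullet> x = 0})"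

text \<open>
  \<open>a, b, c, d\<close> are the vertices of a trapezoid with parallel sides \<open>ab\<close> and \<open>cd\<close>. The order of
  \<open>c\<close> and \<open>d\<close> is immaterial: the legs are \<open>bc, da\<close> or \<open>bd, ca\<close>, whichever do not cross.
  Parallelograms are not excluded here; one inscribed in a great circle is a rectangle, which
  has antipodal vertices and so is singular.
\<close>

definition trapezoid :: "'a::real_vector \<Rightarrow> 'a \<Rightarrow> 'a \<Rightarrow> 'a \<Rightarrow> bool" where
  "trapezoid a b c d \<longleftrightarrow>
     a \<noteq> b \<and> c \<noteq> d \<and> (\<exists>k. d - c = k *\<^sub>R (b - a)) \<and> \<not> collinear {a, b, c, d}"

end

theory Submission
  imports Defs
begin

text \<open>
  At a fixed point the velocities and accelerations vanish. In the plane of the great circle take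
  orthonormal coordinates with first axis along the parallel chords; the trapezoid is then
  symmetric about the second axis, with vertices \<open>(\<plusminus>s, c)\<close> and \<open>(\<plusminus>S, C)\<close>, where \<open>s, c, S > 0\<close> and
  \<open>C \<noteq> 0\<close>. The force between two bodies at angular distance \<open>\<theta>\<close> is tangential, of size \<open>1 / sin\<^sup>2 \<theta>\<close>
  per unit masses. With \<open>u\<close> and \<open>w\<close> the sines of the two angles separating \<open>(S, C)\<close> from \<open>(s, c)\<close> and
  \<open>(-s, c)\<close>, the equilibrium equations at \<open>(s, c)\<close> and \<open>(S, C)\<close> have incompatible signs, because
  \<open>u + w = 2 S c > 0\<close> and \<open>w - u = 2 s C\<close> has the sign of \<open>C\<close>.
\<close>

section \<open>Scalar equilibrium equations on a circle\<close>

text \<open>Note the junk value \<open>pull 0 = 0\<close>.\<close>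

definition pull :: "real \<Rightarrow> real" where
  "pull t = t / \<bar>t\<bar> ^ 3"

lemma pull_minus: "pull (- t) = - pull t"
  by (simp add: pull_def)

lemma pull_pos: "t > 0 \<Longrightarrow> pull t > 0"
  by (simp add: pull_def)

lemma pull_neg: "t < 0 \<Longrightarrow> pull t < 0"
  using pull_pos[of "- t"] by (simp add: pull_minus)

lemma pull_strict_decreasing:
  assumes "0 < a" "a < b"
  shows "pull b < pull a"
proof -
  have *: "pull t = 1 / t\<^sup>2" if "t > 0" for t
    using that by (simp add: pull_def power3_eq_cube power2_eq_square)
  have "a\<^sup>2 < b\<^sup>2"
    using assms by (intro power_strict_mono) auto
  with assms show ?thesis
    by (simp add: * frac_less2)
qed

text \<open>\<open>eq1\<close> makes \<open>pull w < pull u\<close>, and \<open>eq2\<close> gives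
  \<open>pull u + pull w\<close> the sign opposite to \<open>C\<close>. If \<open>C > 0\<close>,
  then \<open>w > 0\<close>, so both pulls are positive. If \<open>C < 0\<close>, then
  \<open>u > \<bar>w\<bar>\<close>, and the decrease of \<open>pull\<close> on positive arguments
  contradicts one of the two.\<close>

lemma no_planar_equilibrium:
  fixes m M s c S C :: real
  assumes "m > 0" "M > 0" "s > 0" "c > 0" "S > 0" "C \<noteq> 0" "S * c + C * s \<noteq> 0"
    and eq1: "M * (pull (S * c - C * s) - pull (S * c + C * s)) = m * pull (2 * s * c)"
    and eq2: "M * pull (2 * S * C) = - (m * (pull (S * c - C * s) + pull (S * c + C * s)))"
  shows False
proof -
  define u where "u = S * c - C * s"
  define w where "w = S * c + C * s"
  have "M * (pull u - pull w) > 0"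
    using eq1 pull_pos[of "2 * s * c"] assms by (simp add: u_def w_def)
  then have less: "pull w < pull u"
    using \<open>M > 0\<close> by (simp add: zero_less_mult_iff)
  have Sc: "S * c > 0"
    using assms by simp
  show False
  proof (cases "C > 0")
    case True
    then have "w > 0"
      using assms by (simp add: w_def add_pos_pos)
    have "m * (pull u + pull w) < 0"
      using eq2 True assms pull_pos[of "2 * S * C"] mult_pos_pos[of M "pull (2 * S * C)"]
      by (simp add: u_def w_def)
    then have "pull u + pull w < 0"
      using \<open>m > 0\<close> by (simp add: mult_less_0_iff)
    with less pull_pos[OF \<open>w > 0\<close>] show False
      by linarith
  next
    case False
    then have "C < 0"
      using assms by simp
    then have Cs: "C * s < 0"
      using assms by (simp add: mult_neg_pos)
    have "pull (2 * S * C) < 0"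
      using \<open>C < 0\<close> assms by (intro pull_neg) (simp add: mult_pos_neg)
    then have "M * pull (2 * S * C) < 0"
      by (rule mult_pos_neg[OF \<open>M > 0\<close>])
    then have "m * (pull u + pull w) > 0"
      using eq2 unfolding u_def w_def by linarith
    then have sum: "pull u + pull w > 0"
      using \<open>m > 0\<close> by (simp add: zero_less_mult_iff)
    show False
    proof (cases "w > 0")
      case True
      then show False
        using pull_strict_decreasing[of w u] less Cs by (simp add: u_def w_def)
    next
      case False
      \<comment> \<open>\<open>w = 0\<close> is excluded by hypothesis.\<close>
      then have "0 < - w" "- w < u"
        using assms Sc by (auto simp: u_def w_def)
      from pull_strict_decreasing[OF this] sum show False
        by (simp add: pull_minus)
    qed
  qed
qed

section \<open>Vectors and forces in the plane of a great circle\<close>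

lemma unit_parallel:
  fixes x y :: "'a::real_inner"
  assumes "x \<bullet> x = 1" "y \<bullet> y = 1" "(x \<bullet> y)\<^sup>2 = 1"
  shows "x = y \<or> x = - y"
proof -
  have "(x - y) \<bullet> (x - y) = 2 - 2 * (x \<bullet> y)" "(x + y) \<bullet> (x + y) = 2 + 2 * (x \<bullet> y)"
    using assms by (simp_all add: inner_diff inner_add inner_commute)
  moreover have "x \<bullet> y = 1 \<or> x \<bullet> y = - 1"
    using assms(3) by (simp add: power2_eq_1_iff)
  ultimately have "x - y = 0 \<or> x + y = 0"
    by (metis add.right_inverse diff_self inner_eq_zero_iff mult.right_neutral mult_minus_right)
  then show ?thesis
    by (auto simp: eq_neg_iff_add_eq_0)
qed

text \<open>The force is paired with the unit tangent at \<open>x\<close>. By Lagrange's identity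
  \<open>1 - (x \<bullet> y)\<^sup>2\<close> is the square of the signed sine
  \<open>c * b - d * a\<close>, which is also the pairing of the numerator.\<close>

lemma tangential_force:
  fixes e f :: "'a::real_inner"
  assumes "e \<bullet> e = 1" "f \<bullet> f = 1" "e \<bullet> f = 0"
    and x: "x = a *\<^sub>R e + b *\<^sub>R f" "a\<^sup>2 + b\<^sup>2 = 1"
    and y: "y = c *\<^sub>R e + d *\<^sub>R f" "c\<^sup>2 + d\<^sup>2 = 1"
  shows "((\<mu> / (1 - (x \<bullet> y)\<^sup>2) powr (3/2)) *\<^sub>R (y - (x \<bullet> y) *\<^sub>R x)) \<bullet> (b *\<^sub>R e - a *\<^sub>R f)
           = \<mu> * pull (c * b - d * a)"
proof -
  have fe: "f \<bullet> e = 0"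
    using assms by (simp add: inner_commute)
  have xy: "x \<bullet> y = a * c + b * d"
    using assms fe by (simp add: inner_add)
  have "1 - (x \<bullet> y)\<^sup>2 = (a\<^sup>2 + b\<^sup>2) * (c\<^sup>2 + d\<^sup>2) - (a * c + b * d)\<^sup>2"
    using x y xy by simp
  also have "\<dots> = \<bar>c * b - d * a\<bar>\<^sup>2"
    by (simp add: power2_eq_square algebra_simps)
  finally have "(1 - (x \<bullet> y)\<^sup>2) powr (3/2) = (\<bar>c * b - d * a\<bar>\<^sup>2) powr (3/2)"
    by simp
  also have "\<dots> = \<bar>c * b - d * a\<bar> ^ 3"
  \<comment> \<open>At zero both sides vanish, since \<open>0 powr (3/2) = 0\<close>.\<close>
  proof (cases "c * b - d * a = 0")
    case False
    then have "(\<bar>c * b - d * a\<bar>\<^sup>2) powr (3/2) = (\<bar>c * b - d * a\<bar> powr 2) powr (3/2)"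
      by (simp add: powr_numeral)
    also have "\<dots> = \<bar>c * b - d * a\<bar> powr 3"
      by (subst powr_powr) simp
    finally show ?thesis
      using False by (simp add: powr_numeral)
  qed simp
  finally have pow: "(1 - (x \<bullet> y)\<^sup>2) powr (3/2) = \<bar>c * b - d * a\<bar> ^ 3" .
  have "x \<bullet> (b *\<^sub>R e - a *\<^sub>R f) = 0" "y \<bullet> (b *\<^sub>R e - a *\<^sub>R f) = c * b - d * a"
    using assms fe by (simp_all add: inner_add inner_diff)
  then have "(y - (x \<bullet> y) *\<^sub>R x) \<bullet> (b *\<^sub>R e - a *\<^sub>R f) = c * b - d * a"
    by (simp add: inner_diff_left)
  then show ?thesis
    by (simp add: pow pull_def)
qed

text \<open>A nonzero remainder \<open>z\<close> would yield four pairwise orthogonal nonzero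
  vectors in dimension three.\<close>

lemma orthonormal_expansion_in_plane:
  fixes e f n x :: "real^3"
  assumes ef: "e \<bullet> e = 1" "f \<bullet> f = 1" "e \<bullet> f = 0"
    and n: "n \<noteq> 0" "n \<bullet> e = 0" "n \<bullet> f = 0" "n \<bullet> x = 0"
  shows "x = (x \<bullet> e) *\<^sub>R e + (x \<bullet> f) *\<^sub>R f"
proof (rule ccontr)
  define z where "z = x - ((x \<bullet> e) *\<^sub>R e + (x \<bullet> f) *\<^sub>R f)"
  assume "\<not> ?thesis"
  then have "z \<noteq> 0"
    by (simp add: z_def)
  have fe: "f \<bullet> e = 0"
    using ef by (simp add: inner_commute)
  have z: "z \<bullet> e = 0" "z \<bullet> f = 0" "n \<bullet> z = 0"
    using ef n fe by (simp_all add: z_def inner_diff inner_add)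
  have nz: "e \<noteq> 0" "f \<noteq> 0"
    using ef by auto
  have "pairwise orthogonal {e, f, n, z}"
    using ef n z by (auto simp: pairwise_def orthogonal_def inner_commute)
  then have "independent {e, f, n, z}"
    using nz n \<open>z \<noteq> 0\<close> by (intro pairwise_orthogonal_independent) auto
  then have "card {e, f, n, z} \<le> 3"
    using independent_bound by force
  moreover have "e \<noteq> f" "e \<noteq> n" "e \<noteq> z" "f \<noteq> n" "f \<noteq> z" "n \<noteq> z"
    using ef n z by (auto simp: inner_commute)
  ultimately show False
    by simp
qed

section \<open>Balance equations at a fixed point\<close>

lemma fixed_pointD:
  assumes "fixed_point \<mu> q"
  shows "nonsingular q" "q i \<bullet> q i = 1"
    and "(\<Sum>j \<in> UNIV - {i}.
        (\<mu> j / (1 - (q i \<bullet> q j)\<^sup>2) powr (3/2)) *\<^sub>R (q j - (q i \<bullet> q j) *\<^sub>R q i)) = 0"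
proof -
  from assms obtain T Q v where sol: "is_solution \<mu> T Q v" "Q 0 = q"
    and v: "\<And>i. v 0 i = 0" "\<And>i. ((\<lambda>s. v s i) has_vector_derivative 0) (at 0)"
    unfolding fixed_point_def by blast
  then have 0: "nonsingular q" "q i \<bullet> q i = 1"
      "((\<lambda>s. v s i) has_vector_derivative acceleration \<mu> q (v 0) i) (at 0)"
    unfolding is_solution_def by fastforce+
  then show "nonsingular q" "q i \<bullet> q i = 1"
    by auto
  \<comment> \<open>Both are derivatives of the velocity at time 0.\<close>
  have "acceleration \<mu> q (v 0) i = 0"
    using 0(3) v(2) by (rule vector_derivative_unique_at)
  then show "(\<Sum>j \<in> UNIV - {i}.
        (\<mu> j / (1 - (q i \<bullet> q j)\<^sup>2) powr (3/2)) *\<^sub>R (q j - (q i \<bullet> q j) *\<^sub>R q i)) = 0"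
    by (simp add: acceleration_def v)
qed

lemma tangential_balance:
  fixes \<mu> :: "4 \<Rightarrow> real" and e f :: "real^3"
  assumes "fixed_point \<mu> q"
    and ef: "e \<bullet> e = 1" "f \<bullet> f = 1" "e \<bullet> f = 0"
    and q: "\<And>i. q i = a i *\<^sub>R e + b i *\<^sub>R f"
  shows "(\<Sum>j \<in> UNIV - {i}. \<mu> j * pull (a j * b i - b j * a i)) = 0"
proof -
  have unit: "(a i)\<^sup>2 + (b i)\<^sup>2 = 1" for i
    using fixed_pointD(2)[OF assms(1), of i] ef
    by (simp add: q inner_add inner_commute power2_eq_square)
  have "(\<Sum>j \<in> UNIV - {i}. \<mu> j * pull (a j * b i - b j * a i))
     = (\<Sum>j \<in> UNIV - {i}. (\<mu> j / (1 - (q i \<bullet> q j)\<^sup>2) powr (3/2)) *\<^sub>R (q j - (q i \<bullet> q j) *\<^sub>R q i))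
         \<bullet> (b i *\<^sub>R e - a i *\<^sub>R f)"
    unfolding inner_sum_left
    by (intro sum.cong refl tangential_force[OF ef q unit q unit, symmetric])
  then show ?thesis
    by (simp add: fixed_pointD(3)[OF assms(1)])
qed

section \<open>Reduction of the trapezoid to the scalar equations\<close>

theorem theorem1:
  fixes \<mu> :: "4 \<Rightarrow> real" and m M :: real
  assumes "m > 0" and "M > 0"
    and "\<mu> 1 = m" and "\<mu> 2 = m" and "\<mu> 3 = M" and "\<mu> 4 = M"
  shows "\<not> (\<exists>q C. fixed_point \<mu> q \<and> great_circle C \<and> (\<forall>i. q i \<in> C) \<and>
            trapezoid (q 1) (q 2) (q 3) (q 4))"
proof
  assume "\<exists>q C. fixed_point \<mu> q \<and> great_circle C \<and> (\<forall>i. q i \<in> C) \<and>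
            trapezoid (q 1) (q 2) (q 3) (q 4)"
  then obtain q C where fp: "fixed_point \<mu> q" and gc: "great_circle C" "\<And>i. q i \<in> C"
    and trap: "trapezoid (q 1) (q 2) (q 3) (q 4)"
    by blast
  from gc obtain n where n: "n \<noteq> 0" "\<And>i. n \<bullet> q i = 0"
    unfolding great_circle_def by auto
  from trap obtain k where k: "q 4 - q 3 = k *\<^sub>R (q 2 - q 1)" and "q 3 \<noteq> q 4"
    unfolding trapezoid_def by metis
  have ns: "q i \<noteq> q j" "q i \<noteq> - q j" if "i \<noteq> j" for i j
    using fixed_pointD(1)[OF fp] that unfolding nonsingular_def by blast+
  have unit: "q i \<bullet> q i = 1" for i
    using fixed_pointD(2)[OF fp] .
  \<comment> \<open>Half the chord from \<open>q 1\<close> to \<open>q 2\<close>, and the distance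
    of its midpoint from the centre; nonsingularity makes both positive.\<close>
  define s c where "s = norm (q 2 - q 1) / 2" and "c = norm (q 1 + q 2) / 2"
  define e f where "e = (1 / (2 * s)) *\<^sub>R (q 2 - q 1)" and "f = (1 / (2 * c)) *\<^sub>R (q 1 + q 2)"
  have s: "s > 0"
    using ns(1)[of 2 1] by (simp add: s_def)
  have c: "c > 0"
    using ns(2)[of 1 2] by (simp add: c_def add_eq_0_iff2)
  have se: "(2 * s) *\<^sub>R e = q 2 - q 1" and cf: "(2 * c) *\<^sub>R f = q 1 + q 2"
    using s c by (simp_all add: e_def f_def)
  have "norm e = 1" "norm f = 1"
    using s c by (simp_all add: e_def f_def s_def c_def)
  \<comment> \<open>\<open>(q 2 - q 1) \<bullet> (q 1 + q 2)\<close> is a difference of equal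
    squared norms.\<close>
  moreover have "e \<bullet> f = 0"
    using unit by (simp add: e_def f_def inner_add inner_diff inner_commute)
  ultimately have ef: "e \<bullet> e = 1" "f \<bullet> f = 1" "e \<bullet> f = 0"
    by (auto simp: norm_eq_1)
  have fe: "f \<bullet> e = 0"
    using ef by (simp add: inner_commute)
  have nef: "n \<bullet> e = 0" "n \<bullet> f = 0"
    using n by (simp_all add: e_def f_def inner_diff inner_add)
  define a b where "a i = q i \<bullet> e" and "b i = q i \<bullet> f" for i
  have q: "q i = a i *\<^sub>R e + b i *\<^sub>R f" for i
    unfolding a_def b_def using orthonormal_expansion_in_plane[OF ef n(1) nef n(2)] .
  have ab: "(a i)\<^sup>2 + (b i)\<^sup>2 = 1" for i
    using unit[of i] ef by (simp add: q inner_add inner_commute power2_eq_square)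
  have "2 *\<^sub>R q 2 = (2 * s) *\<^sub>R e + (2 * c) *\<^sub>R f" "2 *\<^sub>R q 1 = (2 * c) *\<^sub>R f - (2 * s) *\<^sub>R e"
    unfolding se cf by (simp_all add: scaleR_2)
  then have "2 * (q 2 \<bullet> e) = 2 * s" "2 * (q 2 \<bullet> f) = 2 * c"
    "2 * (q 1 \<bullet> e) = - 2 * s" "2 * (q 1 \<bullet> f) = 2 * c"
    unfolding inner_scaleR_left[symmetric]
    using ef fe by (simp_all add: inner_add inner_diff)
  then have ab12: "a 2 = s" "b 2 = c" "a 1 = - s" "b 1 = c"
    by (simp_all add: a_def b_def)
  have "q 4 = q 3 + (k * (2 * s)) *\<^sub>R e"
    using k se by (metis add.commute diff_add_cancel scaleR_scaleR)
  then have b34: "b 4 = b 3"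
    by (simp add: b_def inner_add ef)
  then have "(a 4)\<^sup>2 = (a 3)\<^sup>2"
    using ab[of 3] ab[of 4] by simp
  moreover have "a 4 \<noteq> a 3"
    using b34 \<open>q 3 \<noteq> q 4\<close> by (auto simp: q)
  ultimately have a34: "a 4 = - a 3" "a 3 \<noteq> 0"
    by (auto simp: power2_eq_iff)
  \<comment> \<open>The trapezoid predicate leaves the orientation of \<open>q 3\<close>, \<open>q 4\<close> open; let \<open>q r\<close> be the one
    on the side of \<open>q 2\<close>.\<close>
  obtain l r :: 4 where lr: "l = 3 \<and> r = 4 \<or> l = 4 \<and> r = 3" and "a r > 0"
    using a34 by (metis linorder_neqE_linordered_idom neg_0_less_iff_less)
  then have l: "a l = - a r" "b l = b r"
    using a34 b34 by auto
  have diff: "UNIV - {2 :: 4} = {1, 3, 4}" "UNIV - {3 :: 4} = {1, 2, 4}" "UNIV - {4 :: 4} = {1, 2, 3}"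
    unfolding UNIV_4 by auto
  have mu: "\<mu> l = M" "\<mu> r = M"
    using lr assms by auto
  have bal: "(\<Sum>j \<in> UNIV - {i}. \<mu> j * pull (a j * b i - b j * a i)) = 0" for i
    using tangential_balance[OF fp ef q] .
  have U: "UNIV - {2} = {1, l, r}" "UNIV - {r} = {1, 2, l}"
    and neq: "l \<noteq> r" "l \<noteq> 1" "l \<noteq> 2" "r \<noteq> 1" "r \<noteq> 2"
    using lr diff by (elim disjE; simp add: insert_commute)+
  \<comment> \<open>Balance at \<open>q 2\<close>: the terms come from \<open>q 1\<close>,
    \<open>q l\<close>, \<open>q r\<close>.\<close>
  have "m * pull (- (2 * s * c)) + M * pull (- (a r * c + b r * s)) + M * pull (a r * c - b r * s) = 0"
    using bal[of 2] neq assms mu unfolding U by (simp add: ab12 l algebra_simps)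
  then have eq1: "M * (pull (a r * c - b r * s) - pull (a r * c + b r * s)) = m * pull (2 * s * c)"
    unfolding pull_minus by (simp add: algebra_simps)
  \<comment> \<open>Balance at \<open>q r\<close>: the terms come from \<open>q 1\<close>,
    \<open>q 2\<close>, \<open>q l\<close>.\<close>
  have "m * pull (- (a r * c + b r * s)) + m * pull (- (a r * c - b r * s)) + M * pull (- (2 * a r * b r)) = 0"
    using bal[of r] neq assms mu minus_diff_commute[of "s * b r"] unfolding U by (simp add: ab12 l algebra_simps)
  then have eq2: "M * pull (2 * a r * b r) = - (m * (pull (a r * c - b r * s) + pull (a r * c + b r * s)))"
    unfolding pull_minus by (simp add: algebra_simps)
  \<comment> \<open>Otherwise \<open>q l = - q r\<close>.\<close>
  have "b r \<noteq> 0"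
    using ns(2)[of l r] neq by (auto simp: q l)
  \<comment> \<open>Up to sign this is the sine of the angle between \<open>q l\<close> and
    \<open>q 2\<close>; if it vanished, they would coincide or be antipodal.\<close>
  moreover have "a r * c + b r * s \<noteq> 0"
  proof
    assume w: "a r * c + b r * s = 0"
    have "(q l \<bullet> q 2)\<^sup>2 = (b r * c - a r * s)\<^sup>2"
      using ef fe by (simp add: q[of l] q[of 2] inner_add inner_diff ab12 l algebra_simps)
    also have "\<dots> = ((a r)\<^sup>2 + (b r)\<^sup>2) * (s\<^sup>2 + c\<^sup>2) - (a r * c + b r * s)\<^sup>2"
      by (simp add: power2_eq_square algebra_simps)
    also have "\<dots> = 1"
      using ab[of r] ab[of 2] w by (simp add: ab12)
    finally have "q l = q 2 \<or> q l = - q 2"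
      using unit_parallel unit by blast
    with ns neq show False
      by blast
  qed
  ultimately show False
    using no_planar_equilibrium[OF assms(1,2) s c \<open>a r > 0\<close> _ _ eq1 eq2] by blast
qed

end
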